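(* $\mathfrak{s}_{1/2}^{\infty}\leq\mathrm{non}(\mathcal{E})$ and $\mathrm{cov}(\mathcal{E})\leq\mathfrak{r}_{1/2}^{\infty}$.
   Context: $[\omega]^\omega$ is the set of infinite subsets of $\omega$; subsets of $\omega$ are identified with their characteristic functions in $2^\omega$, which carries the usual product topology and product measure. $\mathcal{E}$ is the $\sigma$-ideal generated by closed sets of measure zero, $\mathrm{non}(\mathcal{E})$ is the least size of a set of reals not in $\mathcal{E}$, and $\mathrm{cov}(\mathcal{E})$ is the least size of a subfamily of $\mathcal{E}$ covering the whole space. For $S,X\in[\omega]^\omega$, $S$ cofinally bisects $X$ if $\frac{|S\cap X\cap n|}{|X\cap n|}=\frac12$ for infinitely many $n\in\omega$ (where $n=\{0,\dots,n-1\}$). $\mathfrak{s}_{1/2}^{\infty}$ is the least cardinality of a family $\mathcal{S}\subseteq[\omega]^\omega$ such that for each $X\in[\omega]^\omega$ some $S\in\mathcal{S}$ cofinally bisects $X$. $\mathfrak{r}_{1/2}^{\infty}$ is the least cardinality of a family $\mathcal{R}\subseteq[\omega]^\omega$ such that there is no $X\in[\omega]^\omega$ that cofinally bisects every $R\in\mathcal{R}$. *)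

theory Defs
  imports "HOL-Probability.Probability"
begin

unbundle cardinal_syntax

(* Cardinals are cardinal orders in the sense of BNF_Cardinal_Order_Relation, compared by \<le>o.
   The value is meaningful only for a nonempty collection, see least_card_attained. *)
definition least_card :: "'a set set \<Rightarrow> 'a rel" where
  "least_card \<A> = (SOME r. \<exists>A\<in>\<A>. r = |A| \<and> (\<forall>B\<in>\<A>. |A| \<le>o |B| ))"

lemma least_card_attained:
  assumes "\<A> \<noteq> {}"
  shows "\<exists>A\<in>\<A>. least_card \<A> = |A| \<and> (\<forall>B\<in>\<A>. |A| \<le>o |B| )"
proof -
  have "\<exists>r\<in>card_of ` \<A>. \<forall>r'\<in>card_of ` \<A>. r \<le>o r'"
    by (rule exists_minim_Card_order) (use assms in \<open>auto simp: card_of_Card_order\<close>)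
  then have "\<exists>r. \<exists>A\<in>\<A>. r = |A| \<and> (\<forall>B\<in>\<A>. |A| \<le>o |B| )"
    by auto
  then show ?thesis
    unfolding least_card_def by (rule someI_ex)
qed

(* The Cantor space 2^\<omega> is the type nat \<Rightarrow> bool: its type-class topology is the product of the
   discrete topologies, and the following is the product of the fair coin measures. *)
definition cantor_measure :: "(nat \<Rightarrow> bool) measure" where
  "cantor_measure = PiM UNIV (\<lambda>_. uniform_count_measure UNIV)"

definition sigma_ideal :: "'a set set \<Rightarrow> bool" where
  "sigma_ideal I \<longleftrightarrow> {} \<in> I \<and> (\<forall>A\<in>I. \<forall>B. B \<subseteq> A \<longrightarrow> B \<in> I) \<and>
     (\<forall>A :: nat \<Rightarrow> 'a set. (\<forall>n. A n \<in> I) \<longrightarrow> (\<Union>n. A n) \<in> I)"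

definition sigma_ideal_generated :: "'a set set \<Rightarrow> 'a set set" where
  "sigma_ideal_generated \<C> = \<Inter>{I. sigma_ideal I \<and> \<C> \<subseteq> I}"

definition ideal_E :: "(nat \<Rightarrow> bool) set set" where
  "ideal_E = sigma_ideal_generated {C. closed C \<and> C \<in> null_sets cantor_measure}"

definition non_ideal :: "'a set set \<Rightarrow> 'a rel" where
  "non_ideal I = least_card {A. A \<notin> I}"

definition cov_ideal :: "'a set set \<Rightarrow> 'a set rel" where
  "cov_ideal I = least_card {\<F>. \<F> \<subseteq> I \<and> \<Union>\<F> = UNIV}"

(* If X \<inter> n is empty, the quotient is 0 / 0 = 0, so such n never count. *)
definition cofinally_bisects :: "nat set \<Rightarrow> nat set \<Rightarrow> bool" where
  "cofinally_bisects S X \<longleftrightarrow>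
     (\<exists>\<^sub>\<infinity>n. real (card (S \<inter> X \<inter> {..<n})) / real (card (X \<inter> {..<n})) = 1 / 2)"

definition s_half_inf :: "nat set rel" where
  "s_half_inf = least_card {\<S>. \<S> \<subseteq> {S. infinite S} \<and>
     (\<forall>X. infinite X \<longrightarrow> (\<exists>S\<in>\<S>. cofinally_bisects S X))}"

definition r_half_inf :: "nat set rel" where
  "r_half_inf = least_card {\<R>. \<R> \<subseteq> {R. infinite R} \<and>
     \<not> (\<exists>X. infinite X \<and> (\<forall>R\<in>\<R>. cofinally_bisects X R))}"

end

theory Submission
  imports Defs
begin

text \<open>
  Fix an infinite set \<open>X\<close> and let \<open>S\<close> be chosen by fair coin tosses. Reading the tosses at the
  successive elements of \<open>X\<close> as steps \<open>1\<close> and \<open>-1\<close> gives a simple random walk on the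
  integers. For \<open>k > 0\<close>, the set \<open>S\<close> contains exactly half of the first \<open>k\<close> elements of
  \<open>X\<close> if and only if the walk is at \<open>0\<close> at time \<open>k\<close>. So a set that does not cofinally bisect \<open>X\<close> yields a walk that avoids
  \<open>0\<close> from some time \<open>m\<close> on. For fixed \<open>m\<close> such walks form a closed set, because each
  position depends on finitely many tosses, and a null set, because the walk is recurrent. Hence the
  sets that do not cofinally bisect \<open>X\<close> form a member of \<open>\<E>\<close>
  (\<open>non_bisecting_in_ideal_E\<close>).

  Recurrence follows from first-step analysis. The probability \<open>p x\<close> that the walk
  started at \<open>x\<close> never visits \<open>0\<close> is the mean of \<open>p (x + 1)\<close> and \<open>p (x - 1)\<close> for
  \<open>x \<noteq> 0\<close>, and \<open>p 0 = 0\<close>. So \<open>p\<close> is linear on each of the two half-lines, and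
  being bounded it vanishes (\<open>prob_no_return_from_0\<close>).

  Both inequalities are then formal. A set outside \<open>\<E>\<close> is not contained in any of these members
  of \<open>\<E>\<close>, so it contains a cofinal bisector of each \<open>X\<close>. If no single set cofinally bisects
  all members of \<open>\<R>\<close>, then the members of \<open>\<E>\<close> that belong to the \<open>R \<in> \<R>\<close> cover the
  Cantor space. The cardinals refer to infinite sets, while points of the Cantor space may be finite
  sets; these cause no trouble because a finite set never cofinally bisects an infinite one
  (\<open>infinite_if_cofinally_bisects\<close>).
\<close>

section \<open>The coin-tossing measure\<close>

lemma prob_space_coin: "prob_space (uniform_count_measure (UNIV :: bool set))"
  by (rule prob_space_uniform_count_measure) auto

interpretation coin: prob_space "uniform_count_measure (UNIV :: bool set)"
  by (rule prob_space_coin)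

interpretation coin_sequence: sequence_space "uniform_count_measure (UNIV :: bool set)" ..

interpretation cantor: prob_space cantor_measure
  unfolding cantor_measure_def by (rule coin_sequence.prob_space_axioms)

lemma space_cantor_measure [simp]: "space cantor_measure = UNIV"
  by (simp add: cantor_measure_def space_PiM space_uniform_count_measure)

lemma measurable_cantor_coordinate [measurable]:
  "(\<lambda>\<omega>. \<omega> i) \<in> measurable cantor_measure (count_space UNIV)"
proof -
  have "(\<lambda>\<omega>. \<omega> i) \<in> measurable cantor_measure (uniform_count_measure (UNIV :: bool set))"
    unfolding cantor_measure_def by (rule measurable_component_singleton) simp
  then show ?thesis
    by (simp only: measurable_cong_sets[OF refl sets_uniform_count_measure_count_space])
qed

text \<open>
  A fair coin toss followed by an independent fair sequence is again a fair sequence, so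
  probabilities can be computed by conditioning on the first toss. This is the only independence
  that enters the recurrence argument.
\<close>
lemma prob_first_toss:
  assumes A: "A \<in> sets cantor_measure"
  shows "cantor.prob A =
    (cantor.prob {\<omega>. case_nat True \<omega> \<in> A} + cantor.prob {\<omega>. case_nat False \<omega> \<in> A}) / 2"
proof -
  let ?C = "uniform_count_measure (UNIV :: bool set)"
  let ?cons = "\<lambda>(s, \<omega>). case_nat s \<omega> :: nat \<Rightarrow> bool"
  let ?B = "?cons -` A \<inter> space (?C \<Otimes>\<^sub>M cantor_measure)"
  have half: "ennreal (1 / 2) * ennreal x = ennreal (x / 2)" for x
    by (subst ennreal_mult'[symmetric]) auto
  have iter: "distr (?C \<Otimes>\<^sub>M cantor_measure) cantor_measure ?cons = cantor_measure"
    using coin_sequence.PiM_iter by (simp add: cantor_measure_def)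
  have meas: "?cons \<in> measurable (?C \<Otimes>\<^sub>M cantor_measure) cantor_measure"
    unfolding cantor_measure_def by measurable
  have B: "?B \<in> sets (?C \<Otimes>\<^sub>M cantor_measure)"
    using meas A by (rule measurable_sets)
  have "emeasure cantor_measure A = emeasure (?C \<Otimes>\<^sub>M cantor_measure) ?B"
    using emeasure_distr[OF meas A] by (simp add: iter)
  also have "\<dots> = (\<integral>\<^sup>+ s. emeasure cantor_measure (Pair s -` ?B) \<partial>?C)"
    by (rule cantor.emeasure_pair_measure_alt[OF B])
  also have "\<dots> = (\<integral>\<^sup>+ s. emeasure cantor_measure {\<omega>. case_nat s \<omega> \<in> A} \<partial>?C)"
    by (intro nn_integral_cong arg_cong2[where f = emeasure])
      (auto simp: space_pair_measure space_uniform_count_measure)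
  also have "\<dots> = (\<Sum>s\<in>UNIV. ennreal (1 / 2) * emeasure cantor_measure {\<omega>. case_nat s \<omega> \<in> A})"
    unfolding uniform_count_measure_def
    by (subst nn_integral_point_measure_finite) (auto simp: card_UNIV_bool)
  also have "\<dots> = ennreal ((cantor.prob {\<omega>. case_nat True \<omega> \<in> A}
      + cantor.prob {\<omega>. case_nat False \<omega> \<in> A}) / 2)"
    unfolding UNIV_bool cantor.emeasure_eq_measure half
    by (simp add: ennreal_plus[symmetric] add_divide_distrib ac_simps del: ennreal_plus)
  finally show ?thesis
    by (simp add: cantor.emeasure_eq_measure)
qed

text \<open>
  Tosses read off along distinct positions form again a fair sequence. With \<open>e\<close> the enumeration of
  an infinite set \<open>X\<close>, this reduces the bisection of \<open>X\<close> to the bisection of the set of all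
  natural numbers.
\<close>
lemma distr_cantor_reindex:
  fixes e :: "nat \<Rightarrow> nat"
  assumes "inj e"
  shows "distr cantor_measure cantor_measure (\<lambda>\<omega>. \<omega> \<circ> e) = cantor_measure"
proof -
  have "distr cantor_measure cantor_measure (\<lambda>\<omega>. \<lambda>n\<in>UNIV. \<omega> (e n)) = cantor_measure"
    unfolding cantor_measure_def
    by (rule distr_PiM_reindex) (use assms prob_space_coin in auto)
  then show ?thesis
    by (simp add: comp_def restrict_UNIV)
qed

lemma measurable_cantor_reindex [measurable]:
  fixes e :: "nat \<Rightarrow> nat"
  shows "(\<lambda>\<omega>. \<omega> \<circ> e) \<in> measurable cantor_measure cantor_measure"
proof -
  have "(\<lambda>\<omega>. \<lambda>n\<in>UNIV. \<omega> (e n)) \<in> measurable cantor_measure cantor_measure"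
    unfolding cantor_measure_def by measurable
  then show ?thesis
    by (simp add: comp_def restrict_UNIV)
qed

section \<open>Recurrence of the simple random walk\<close>

definition walk :: "(nat \<Rightarrow> bool) \<Rightarrow> nat \<Rightarrow> int" where
  "walk \<omega> n = (\<Sum>i<n. if \<omega> i then 1 else -1)"

lemma walk_0 [simp]: "walk \<omega> 0 = 0"
  by (simp add: walk_def)

lemma walk_case_nat: "walk (case_nat s \<omega>) (Suc n) = (if s then 1 else -1) + walk \<omega> n"
  unfolding walk_def by (subst sum.lessThan_Suc_shift) simp

text \<open>
  The starting point \<open>x\<close> is a parameter because conditioning on the first toss moves it.
\<close>
definition no_return_from :: "nat \<Rightarrow> int \<Rightarrow> (nat \<Rightarrow> bool) set" where
  "no_return_from m x = {\<omega>. \<forall>n\<ge>m. x + walk \<omega> n \<noteq> 0}"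

text \<open>
  The target is the discrete \<open>int\<close>, so one splits into countably many cases according to the
  previous position.
\<close>
lemma measurable_walk [measurable]:
  "(\<lambda>\<omega>. walk \<omega> n) \<in> measurable cantor_measure (count_space UNIV)"
proof (induction n)
  case (Suc n)
  have "(\<lambda>\<omega>. if \<omega> n then k + 1 else k - 1) \<in> measurable cantor_measure (count_space UNIV)"
    for k :: int
    by measurable
  from measurable_compose_countable[OF this Suc] show ?case
    by (simp add: walk_def if_distrib cong: if_cong)
qed simp

lemma no_return_from_measurable [measurable]: "no_return_from m x \<in> sets cantor_measure"
proof -
  have "{\<omega> \<in> space cantor_measure. \<forall>n\<ge>m. x + walk \<omega> n \<noteq> 0} \<in> sets cantor_measure"
    by measurable
  then show ?thesis
    by (simp add: no_return_from_def)
qed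

lemma all_ge_Suc_iff: "(\<forall>n\<ge>Suc m. P n) \<longleftrightarrow> (\<forall>n\<ge>m. P (Suc n))"
  by (metis Suc_le_D Suc_le_mono)

lemma prob_no_return_from_Suc:
  "cantor.prob (no_return_from (Suc m) x) =
    (cantor.prob (no_return_from m (x + 1)) + cantor.prob (no_return_from m (x - 1))) / 2"
proof -
  have "{\<omega>. case_nat True \<omega> \<in> no_return_from (Suc m) x} = no_return_from m (x + 1)"
    and "{\<omega>. case_nat False \<omega> \<in> no_return_from (Suc m) x} = no_return_from m (x - 1)"
    unfolding no_return_from_def
    by (simp_all add: all_ge_Suc_iff walk_case_nat algebra_simps)
  then show ?thesis
    using prob_first_toss[OF no_return_from_measurable[of "Suc m" x]] by simp
qed

lemma no_return_from_0: "x \<noteq> 0 \<Longrightarrow> no_return_from 0 x = no_return_from (Suc 0) x"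
  by (auto simp: no_return_from_def) (metis add_0_right less_Suc0 linorder_not_less walk_0)

lemma no_return_from_0_0: "no_return_from 0 0 = {}"
  by (auto simp: no_return_from_def intro: exI[of _ 0])

text \<open>
  The harmonicity condition says that the second differences vanish, so \<open>p n = n * p 1\<close>, which is
  bounded only if \<open>p 1 = 0\<close>.
\<close>
lemma bounded_half_line_harmonic_zero:
  fixes p :: "nat \<Rightarrow> real"
  assumes zero: "p 0 = 0" and harmonic: "\<And>n. p (Suc n) = (p (Suc (Suc n)) + p n) / 2"
    and bounded: "\<And>n. \<bar>p n\<bar> \<le> c"
  shows "p n = 0"
proof -
  have linear: "p n = real n * p 1 \<and> p (Suc n) = real (Suc n) * p 1" for n
  proof (induction n)
    case 0
    then show ?case by (simp add: zero)
  next
    case (Suc n)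
    then show ?case using harmonic[of n] by (simp add: algebra_simps)
  qed
  have "p 1 = 0"
  proof (rule ccontr)
    assume "p 1 \<noteq> 0"
    then obtain k :: nat where "c < real k * \<bar>p 1\<bar>"
      using ex_less_of_nat_mult[of "\<bar>p 1\<bar>" c] by auto
    also have "\<dots> = \<bar>p k\<bar>"
      using linear[of k] by (simp add: abs_mult)
    also have "\<dots> \<le> c"
      by (rule bounded)
    finally show False by simp
  qed
  then show ?thesis
    using linear[of n] by simp
qed

text \<open>
  First-step analysis makes the avoidance probability harmonic away from \<open>0\<close>. A walk cannot jump
  over \<open>0\<close>, so the two half-lines are treated independently.
\<close>
lemma prob_no_return_from_0: "cantor.prob (no_return_from 0 x) = 0"
proof -
  let ?p = "\<lambda>x. cantor.prob (no_return_from 0 x)"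
  have zero: "?p 0 = 0"
    by (simp add: no_return_from_0_0)
  have harmonic: "?p x = (?p (x + 1) + ?p (x - 1)) / 2" if "x \<noteq> 0" for x
    using prob_no_return_from_Suc[of 0 x] by (simp only: no_return_from_0[OF that])
  have "?p (int (Suc n)) = (?p (int (Suc (Suc n))) + ?p (int n)) / 2" for n
    using harmonic[of "int (Suc n)"] by (simp add: algebra_simps)
  then have right: "?p (int n) = 0" for n
    using zero by - (rule bounded_half_line_harmonic_zero[where p = "\<lambda>n. ?p (int n)" and c = 1], auto simp del: of_nat_Suc)
  have "?p (- int (Suc n)) = (?p (- int (Suc (Suc n))) + ?p (- int n)) / 2" for n
    using harmonic[of "- int (Suc n)"] by (simp add: algebra_simps)
  then have left: "?p (- int n) = 0" for n
    using zero by - (rule bounded_half_line_harmonic_zero[where p = "\<lambda>n. ?p (- int n)" and c = 1], auto simp del: of_nat_Suc)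
  show ?thesis
    using left right by (cases x rule: int_cases2) simp_all
qed

text \<open>
  Recurrence: by conditioning on the first \<open>m\<close> tosses, avoiding \<open>0\<close> from time \<open>m\<close> on reduces
  to avoiding \<open>0\<close> altogether from the position reached.
\<close>
lemma prob_no_return_from: "cantor.prob (no_return_from m x) = 0"
  by (induction m arbitrary: x) (simp_all add: prob_no_return_from_0 prob_no_return_from_Suc)

section \<open>Bisection and the ideal of closed null sets\<close>

lemma sigma_ideal_Inter:
  assumes ideal: "\<And>I. I \<in> \<I> \<Longrightarrow> sigma_ideal I"
  shows "sigma_ideal (\<Inter>\<I>)"
  unfolding sigma_ideal_def
proof (intro conjI ballI allI impI InterI)
  fix I assume I: "I \<in> \<I>"
  note I_ideal = ideal[OF I, unfolded sigma_ideal_def]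
  show "{} \<in> I"
    using I_ideal by simp
  show "B \<in> I" if "A \<in> \<Inter>\<I>" "B \<subseteq> A" for A B
    using I_ideal that I by blast
  show "(\<Union>n. A n) \<in> I" if "\<forall>n. A n \<in> \<Inter>\<I>" for A :: "nat \<Rightarrow> _"
  proof -
    have "\<forall>n. A n \<in> I"
      using that I by blast
    then show ?thesis
      using I_ideal by simp
  qed
qed

lemma sigma_ideal_ideal_E: "sigma_ideal ideal_E"
  unfolding ideal_E_def sigma_ideal_generated_def by (rule sigma_ideal_Inter) simp

lemma closed_null_in_ideal_E: "closed C \<Longrightarrow> C \<in> null_sets cantor_measure \<Longrightarrow> C \<in> ideal_E"
  unfolding ideal_E_def sigma_ideal_generated_def by blast

lemma ideal_E_subset: "A \<in> ideal_E \<Longrightarrow> B \<subseteq> A \<Longrightarrow> B \<in> ideal_E"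
  using sigma_ideal_ideal_E by (auto simp: sigma_ideal_def)

lemma ideal_E_UN: "(\<And>n :: nat. A n \<in> ideal_E) \<Longrightarrow> (\<Union>n. A n) \<in> ideal_E"
  using sigma_ideal_ideal_E by (auto simp: sigma_ideal_def)

text \<open>
  The subsets of null sets form a \<open>\<sigma>\<close>-ideal that contains the generators of \<open>\<E>\<close> but not the
  whole space. This ensures that the minimum defining \<open>non_ideal ideal_E\<close> is attained.
\<close>
lemma UNIV_notin_ideal_E: "UNIV \<notin> ideal_E"
proof
  let ?I = "{A. \<exists>N\<in>null_sets cantor_measure. A \<subseteq> N}"
  assume "UNIV \<in> ideal_E"
  moreover have "sigma_ideal ?I"
    unfolding sigma_ideal_def
  proof (intro conjI allI impI)
    fix A :: "nat \<Rightarrow> (nat \<Rightarrow> bool) set"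
    assume "\<forall>n. A n \<in> ?I"
    then obtain N where "\<And>n. N n \<in> null_sets cantor_measure" "\<And>n. A n \<subseteq> N n"
      by simp metis
    then show "(\<Union>n. A n) \<in> ?I"
      by (auto intro!: bexI[of _ "\<Union>n. N n"])
  qed auto
  ultimately have "UNIV \<in> ?I"
    unfolding ideal_E_def sigma_ideal_generated_def by blast
  then have "space cantor_measure \<in> null_sets cantor_measure"
    by (auto simp: top.extremum_unique)
  then show False
    using cantor.emeasure_space_1 by auto
qed

text \<open>
  Each position of the walk is a continuous function into the discrete integers, and avoidance of
  \<open>0\<close> is an intersection of conditions on single positions.
\<close>
lemma closed_no_return_along:
  fixes e :: "nat \<Rightarrow> nat"
  shows "closed {\<omega>. \<omega> \<circ> e \<in> no_return_from m x}"
proof -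
  have "continuous_on UNIV (\<lambda>\<omega>. if \<omega> i then 1 else -1 :: int)" for i :: nat
    by (rule continuous_on_compose2[where t = UNIV and g = "\<lambda>b. if b then 1 else -1"]) auto
  then have "continuous_on UNIV (\<lambda>\<omega>. walk (\<omega> \<circ> e) n)" for n
    unfolding walk_def comp_def by (intro continuous_on_sum) simp
  then have "closed ((\<lambda>\<omega>. walk (\<omega> \<circ> e) n) -` {y. x + y \<noteq> 0})" for n
    by (intro closed_vimage) (auto simp: closed_def intro: Topological_Spaces.open_discrete)
  then have "closed (\<Inter>n\<in>{m..}. (\<lambda>\<omega>. walk (\<omega> \<circ> e) n) -` {y. x + y \<noteq> 0})"
    by auto
  moreover have "(\<Inter>n\<in>{m..}. (\<lambda>\<omega>. walk (\<omega> \<circ> e) n) -` {y. x + y \<noteq> 0})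
      = {\<omega>. \<omega> \<circ> e \<in> no_return_from m x}"
    by (auto simp: no_return_from_def)
  ultimately show ?thesis by simp
qed

lemma null_no_return_along:
  assumes "inj e"
  shows "{\<omega>. \<omega> \<circ> e \<in> no_return_from m x} \<in> null_sets cantor_measure"
proof -
  have "emeasure cantor_measure {\<omega>. \<omega> \<circ> e \<in> no_return_from m x} =
      emeasure (distr cantor_measure cantor_measure (\<lambda>\<omega>. \<omega> \<circ> e)) (no_return_from m x)"
    by (subst emeasure_distr) (auto intro: arg_cong2[where f = emeasure])
  also have "\<dots> = 0"
    by (simp add: distr_cantor_reindex[OF assms] cantor.emeasure_eq_measure prob_no_return_from)
  finally have "emeasure cantor_measure {\<omega>. \<omega> \<circ> e \<in> no_return_from m x} = 0" .
  moreover have "{\<omega>. \<omega> \<circ> e \<in> no_return_from m x} \<in> sets cantor_measure"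
    using measurable_sets[OF measurable_cantor_reindex no_return_from_measurable, of e m x]
    by (simp add: vimage_def)
  ultimately show ?thesis by auto
qed

lemma Int_lessThan_enumerate:
  fixes X :: "nat set"
  assumes "infinite X"
  shows "X \<inter> {..<enumerate X k} = enumerate X ` {..<k}"
proof
  show "enumerate X ` {..<k} \<subseteq> X \<inter> {..<enumerate X k}"
    using assms by (auto simp: enumerate_in_set)
  show "X \<inter> {..<enumerate X k} \<subseteq> enumerate X ` {..<k}"
  proof
    fix y assume y: "y \<in> X \<inter> {..<enumerate X k}"
    then obtain j where "y = enumerate X j"
      using enumerate_Ex[OF assms] by blast
    with y assms show "y \<in> enumerate X ` {..<k}"
      by auto
  qed
qed

lemma walk_eq_card: "walk \<omega> n = 2 * int (card {i. i < n \<and> \<omega> i}) - int n"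
proof (induction n)
  case (Suc n)
  have "{i. i < Suc n \<and> \<omega> i} = (if \<omega> n then insert n {i. i < n \<and> \<omega> i} else {i. i < n \<and> \<omega> i})"
    by (auto simp: less_Suc_eq)
  then show ?case
    using Suc by (simp add: walk_def)
qed simp

text \<open>
  If the walk is at \<open>0\<close> at time \<open>k\<close>, then exactly half of the first \<open>k\<close> elements of \<open>X\<close>
  are chosen, and these are the elements of \<open>X\<close> below its element number \<open>k\<close>, counted from
  \<open>0\<close>.
\<close>
lemma cofinally_bisects_if_walk_returns:
  fixes X :: "nat set"
  assumes X: "infinite X" and returns: "\<exists>\<^sub>\<infinity>k. walk (\<omega> \<circ> enumerate X) k = 0"
  shows "cofinally_bisects (Collect \<omega>) X"
  unfolding cofinally_bisects_def INFM_nat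
proof
  fix m
  let ?e = "enumerate X"
  have inj: "inj ?e"
    using X by (rule inj_enumerate)
  \<comment> \<open>The strict inequality makes \<open>k\<close> positive, which excludes the quotient \<open>0 / 0\<close>.\<close>
  obtain k where k: "k > m" "walk (\<omega> \<circ> ?e) k = 0"
    using returns unfolding INFM_nat by blast
  have "Collect \<omega> \<inter> X \<inter> {..<?e k} = ?e ` {i. i < k \<and> (\<omega> \<circ> ?e) i}"
    using Int_lessThan_enumerate[OF X, of k] by auto
  then have "card (Collect \<omega> \<inter> X \<inter> {..<?e k}) = card {i. i < k \<and> (\<omega> \<circ> ?e) i}"
    using inj by (simp add: card_image inj_on_subset[OF inj])
  moreover have "card (X \<inter> {..<?e k}) = k"
    using inj by (simp add: Int_lessThan_enumerate[OF X] card_image inj_on_subset[OF inj])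
  moreover have "k = 2 * card {i. i < k \<and> (\<omega> \<circ> ?e) i}"
    using k(2) walk_eq_card[of "\<omega> \<circ> ?e" k] by linarith
  ultimately have "real (card (Collect \<omega> \<inter> X \<inter> {..<?e k})) / real (card (X \<inter> {..<?e k})) = 1 / 2"
    using k(1) by (simp add: field_simps)
  moreover have "?e k > m"
    using le_enumerate[OF X, of k] k(1) by linarith
  ultimately show "\<exists>n>m. real (card (Collect \<omega> \<inter> X \<inter> {..<n})) / real (card (X \<inter> {..<n})) = 1 / 2"
    by blast
qed

lemma non_bisecting_in_ideal_E:
  assumes "infinite X"
  shows "{\<omega>. \<not> cofinally_bisects (Collect \<omega>) X} \<in> ideal_E"
proof (rule ideal_E_subset)
  show "(\<Union>m. {\<omega>. \<omega> \<circ> enumerate X \<in> no_return_from m 0}) \<in> ideal_E"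
    using assms by (intro ideal_E_UN closed_null_in_ideal_E closed_no_return_along
        null_no_return_along inj_enumerate)
  show "{\<omega>. \<not> cofinally_bisects (Collect \<omega>) X} \<subseteq> (\<Union>m. {\<omega>. \<omega> \<circ> enumerate X \<in> no_return_from m 0})"
    using cofinally_bisects_if_walk_returns[OF assms]
    by (simp add: subset_iff no_return_from_def INFM_nat_le) blast
qed

text \<open>
  At a point where \<open>S\<close> bisects \<open>X\<close>, the set \<open>X\<close> has had at most \<open>2 * card S\<close> elements
  if \<open>S\<close> is finite, which fails from some point on.
\<close>
lemma infinite_if_cofinally_bisects:
  assumes X: "infinite X" and S: "cofinally_bisects S X"
  shows "infinite S"
proof
  assume fin: "finite S"
  let ?k = "2 * card S + 1"
  obtain n where n: "n > enumerate X ?k"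
    and half: "real (card (S \<inter> X \<inter> {..<n})) / real (card (X \<inter> {..<n})) = 1 / 2"
    using S unfolding cofinally_bisects_def INFM_nat by blast
  have "?k = card (X \<inter> {..<enumerate X ?k})"
    using inj_enumerate[OF X]
    by (simp add: Int_lessThan_enumerate[OF X] card_image inj_on_subset[OF inj_enumerate[OF X]])
  also have "\<dots> \<le> card (X \<inter> {..<n})"
    using n by (intro card_mono) auto
  also have "\<dots> = 2 * card (S \<inter> X \<inter> {..<n})"
    using half by (cases "card (X \<inter> {..<n}) = 0") (auto simp: field_simps)
  also have "\<dots> \<le> 2 * card S"
    using fin by (intro mult_le_mono card_mono) auto
  finally show False by simp
qed

text \<open>
  A quotient that is \<open>1\<close> or \<open>0 / 0\<close> is never \<open>1 / 2\<close>. Hence no infinite set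
  cofinally bisects all infinite sets, and the minimum defining \<open>r_half_inf\<close> is attained.
\<close>
lemma not_cofinally_bisects_self: "\<not> cofinally_bisects X X"
  by (simp add: cofinally_bisects_def divide_self_if)

section \<open>The two cardinal inequalities\<close>

lemma least_card_le: "A \<in> \<A> \<Longrightarrow> least_card \<A> \<le>o |A|"
  using least_card_attained[of \<A>] by (metis empty_iff)

lemma s_half_inf_le_non_ideal_E: "s_half_inf \<le>o non_ideal ideal_E"
proof -
  obtain A where A: "A \<notin> ideal_E" and card: "non_ideal ideal_E = |A|"
    using least_card_attained[of "{A. A \<notin> ideal_E}"] UNIV_notin_ideal_E
    unfolding non_ideal_def by blast
  let ?\<S> = "{S \<in> Collect ` A. infinite S}"
  have "\<exists>S\<in>?\<S>. cofinally_bisects S X" if X: "infinite X" for X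
  proof -
    have "\<not> A \<subseteq> {\<omega>. \<not> cofinally_bisects (Collect \<omega>) X}"
      using A ideal_E_subset[OF non_bisecting_in_ideal_E[OF X]] by blast
    then show ?thesis
      using infinite_if_cofinally_bisects[OF X] by blast
  qed
  then have "s_half_inf \<le>o |?\<S>|"
    unfolding s_half_inf_def by (intro least_card_le) auto
  also have "|?\<S>| \<le>o |Collect ` A|"
    by (rule card_of_mono1) auto
  also have "|Collect ` A| \<le>o |A|"
    by (rule card_of_image)
  finally show ?thesis
    by (simp add: card)
qed

lemma cov_ideal_E_le_r_half_inf: "cov_ideal ideal_E \<le>o r_half_inf"
proof -
  let ?unbisected = "{\<R>. \<R> \<subseteq> {R. infinite R} \<and>
    \<not> (\<exists>X. infinite X \<and> (\<forall>R\<in>\<R>. cofinally_bisects X R))}"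
  have "\<exists>R\<in>{R. infinite R}. \<not> cofinally_bisects X R" if "infinite X" for X
    using that not_cofinally_bisects_self[of X] by (intro bexI[of _ X]) simp_all
  then have "{R. infinite R} \<in> ?unbisected"
    by blast
  then obtain \<R> where R: "\<R> \<in> ?unbisected" and card: "r_half_inf = |\<R>|"
    using least_card_attained[of ?unbisected] unfolding r_half_inf_def by blast
  let ?N = "\<lambda>R. {\<omega>. \<not> cofinally_bisects (Collect \<omega>) R}"
  \<comment> \<open>The assumption on \<open>\<R>\<close> concerns infinite sets only. For a finite one any member of
    \<open>\<R>\<close> serves, and \<open>\<R>\<close> is nonempty since otherwise every infinite set would vacuously
    bisect all its members.\<close>
  have "\<exists>R\<in>\<R>. \<omega> \<in> ?N R" for \<omega>
  proof (cases "finite (Collect \<omega>)")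
    case True
    moreover obtain R where "R \<in> \<R>" "infinite R"
      using R infinite_UNIV_nat by blast
    ultimately show ?thesis
      using infinite_if_cofinally_bisects by blast
  next
    case False
    then show ?thesis using R by blast
  qed
  then have "\<Union>(?N ` \<R>) = UNIV"
    by blast
  moreover have "?N ` \<R> \<subseteq> ideal_E"
    using R non_bisecting_in_ideal_E by blast
  ultimately have "cov_ideal ideal_E \<le>o |?N ` \<R>|"
    unfolding cov_ideal_def by (intro least_card_le) auto
  also have "|?N ` \<R>| \<le>o |\<R>|"
    by (rule card_of_image)
  finally show ?thesis
    by (simp add: card)
qed

theorem corollary3p2:
  shows "s_half_inf \<le>o non_ideal ideal_E \<and> cov_ideal ideal_E \<le>o r_half_inf"
  using s_half_inf_le_non_ideal_E cov_ideal_E_le_r_half_inf by blast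

end
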